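(* Let $(\mathcal{X},\mathcal{F})$ be a measurable space with a filtration $(\mathcal{F}_n)_{n\ge 0}$, let $\mathbb{P}$ be a probability measure on it, consider the simple hypothesis $H=\{\mathbb{P}\}$ and fix a level $\alpha>0$. Let $\phi:\mathcal{X}\to[0,1]$ be an $\mathcal{F}$-measurable test and let $(\phi_n)_{n\ge0}$ be its induced sequential test, $\phi_n:=\mathbb{E}^{\mathbb{P}}[\phi\mid\mathcal{F}_n]$. Then: 1. If $\phi$ is valid, then $(\phi_n)$ is anytime valid. 2. If $\phi$ is not valid, then $\phi_\tau$ is not valid for any (possibly infinite) stopping time $\tau$ with respect to $(\mathcal{F}_n)$. 3. If $\tau$ is a (possibly infinite) stopping time and $\phi$ is $\mathcal{F}_\tau$-measurable, then $\phi_\tau=\phi$, $\mathbb{P}$-almost surely.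
   Context: $(\mathcal{F}_n)_{n\ge0}$ is a filtration with $\mathcal{F}_n\subseteq\mathcal{F}$, $\mathcal{F}_0=\{\emptyset,\mathcal{X}\}$, and $\mathcal{F}_\infty:=\sigma(\bigcup_{n\ge0}\mathcal{F}_n)\subseteq\mathcal{F}$. A test is an $\mathcal{F}$-measurable map $\phi:\mathcal{X}\to[0,1]$. A test $\phi$ is valid for a hypothesis $H$ (a collection of probability measures) if $\sup_{\mathbb{P}\in H}\mathbb{E}^{\mathbb{P}}[\phi]\le\alpha$. A sequential test is a sequence of tests $(\phi_n)_{n\ge0}$ adapted to $(\mathcal{F}_n)$; it is anytime valid for $H$ if $\phi_\tau$ is valid for $H$ for every (possibly infinite) stopping time $\tau$ with respect to $(\mathcal{F}_n)$, where $\phi_\infty:=\limsup_{n\to\infty}\phi_n$. For a stopping time $\tau$, $\mathcal{F}_\tau=\{A\in\mathcal{F}_\infty: A\cap\{\tau\le n\}\in\mathcal{F}_n\ \forall n\ge0\}$. Conditional expectations are defined up to $\mathbb{P}$-null sets. *)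

theory Defs
  imports "HOL-Probability.Probability"
begin

definition is_test :: "'a measure \<Rightarrow> ('a \<Rightarrow> real) \<Rightarrow> bool" where
  "is_test M \<phi> \<longleftrightarrow> \<phi> \<in> borel_measurable M \<and> (\<forall>x\<in>space M. \<phi> x \<in> {0..1})"

text \<open>The supremum is taken in \<^typ>\<open>ereal\<close>, where it exists for every \<open>H\<close>.\<close>

definition valid :: "real \<Rightarrow> 'a measure set \<Rightarrow> ('a \<Rightarrow> real) \<Rightarrow> bool" where
  "valid \<alpha> H \<phi> \<longleftrightarrow> (SUP P\<in>H. ereal (integral\<^sup>L P \<phi>)) \<le> ereal \<alpha>"

definition sequential_test :: "'a measure \<Rightarrow> (nat \<Rightarrow> 'a measure) \<Rightarrow> (nat \<Rightarrow> 'a \<Rightarrow> real) \<Rightarrow> bool" where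
  "sequential_test M F \<phi>s \<longleftrightarrow> (\<forall>n. is_test M (\<phi>s n) \<and> \<phi>s n \<in> borel_measurable (F n))"

text \<open>A filtration indexed by \<^typ>\<open>nat\<close> is extended to \<^typ>\<open>enat\<close> by the \<open>\<sigma>\<close>-algebra generated by
  its union. The library's notions of stopping time and of the \<open>\<sigma>\<close>-algebra of a stopping time,
  instantiated to the extended filtration, are then the usual ones for possibly infinite
  stopping times; see \<open>stopping_time_extend_iff\<close> and \<open>sets_pre_sigma_extend\<close> below.\<close>

definition extend_filtration :: "'a set \<Rightarrow> (nat \<Rightarrow> 'a measure) \<Rightarrow> enat \<Rightarrow> 'a measure" where
  "extend_filtration \<Omega> F t = (case t of enat n \<Rightarrow> F n | \<infinity> \<Rightarrow> sigma \<Omega> (\<Union>n. sets (F n)))"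

text \<open>The real-valued limit superior is computed in \<^typ>\<open>ereal\<close>; for sequences in \<open>[0,1]\<close>, the only
  ones to which it is applied, the conversion back is exact.\<close>

definition stopped_test :: "(nat \<Rightarrow> 'a \<Rightarrow> real) \<Rightarrow> ('a \<Rightarrow> enat) \<Rightarrow> 'a \<Rightarrow> real" where
  "stopped_test \<phi>s \<tau> x =
    (case \<tau> x of enat n \<Rightarrow> \<phi>s n x | \<infinity> \<Rightarrow> real_of_ereal (limsup (\<lambda>n. ereal (\<phi>s n x))))"

definition anytime_valid ::
  "real \<Rightarrow> 'a measure set \<Rightarrow> 'a set \<Rightarrow> (nat \<Rightarrow> 'a measure) \<Rightarrow> (nat \<Rightarrow> 'a \<Rightarrow> real) \<Rightarrow> bool" where
  "anytime_valid \<alpha> H \<Omega> F \<phi>s \<longleftrightarrow>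
    (\<forall>\<tau>. stopping_time (extend_filtration \<Omega> F) \<tau> \<longrightarrow> valid \<alpha> H (stopped_test \<phi>s \<tau>))"

text \<open>Conditional expectations are determined only up to null sets, so being the induced sequential
  test is a property of \<open>\<phi>s\<close>: each \<open>\<phi>s n\<close> is some \<open>[0,1]\<close>-valued, \<open>F n\<close>-measurable version.\<close>

definition induced_sequential_test ::
  "'a measure \<Rightarrow> (nat \<Rightarrow> 'a measure) \<Rightarrow> ('a \<Rightarrow> real) \<Rightarrow> (nat \<Rightarrow> 'a \<Rightarrow> real) \<Rightarrow> bool" where
  "induced_sequential_test P F \<phi> \<phi>s \<longleftrightarrow>
    sequential_test P F \<phi>s \<and> (\<forall>n. AE x in P. \<phi>s n x = real_cond_exp P (F n) \<phi> x)"

lemma extend_filtration_simps [simp]: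
  "extend_filtration \<Omega> F (enat n) = F n"
  "extend_filtration \<Omega> F \<infinity> = sigma \<Omega> (\<Union>n. sets (F n))"
  by (simp_all add: extend_filtration_def)

lemma filtration_extend:
  assumes "filtration \<Omega> F"
  shows "filtration \<Omega> (extend_filtration \<Omega> F)"
proof -
  interpret filtration \<Omega> F by fact
  have sub: "(\<Union>n. sets (F n)) \<subseteq> Pow \<Omega>"
    using sets.space_closed[of "F _"] by (auto simp: space_F)
  show ?thesis
  proof
    show "space (extend_filtration \<Omega> F i) = \<Omega>" for i
      using sub by (cases i) (simp_all add: space_F space_measure_of)
    show "sets (extend_filtration \<Omega> F i) \<le> sets (extend_filtration \<Omega> F j)" if "i \<le> j" for i j
      using that sub sets_F_mono by (cases i; cases j) (auto simp: sets_measure_of)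
  qed
qed

lemma stopping_time_extend_iff:
  assumes "filtration \<Omega> F"
  shows "stopping_time (extend_filtration \<Omega> F) \<tau> \<longleftrightarrow> (\<forall>n. {x\<in>\<Omega>. \<tau> x \<le> enat n} \<in> sets (F n))"
proof -
  interpret filtration \<Omega> F by fact
  have "(\<forall>t. Q t) \<longleftrightarrow> (\<forall>n. Q (enat n)) \<and> Q \<infinity>" for Q
    by (metis enat.exhaust)
  then show ?thesis
    by (simp add: stopping_time_def pred_def space_F)
qed

lemma sets_pre_sigma_extend:
  assumes F: "filtration \<Omega> F" and \<tau>: "stopping_time (extend_filtration \<Omega> F) \<tau>"
  shows "sets (filtration.pre_sigma \<Omega> (extend_filtration \<Omega> F) \<tau>) =
    {A \<in> sets (sigma \<Omega> (\<Union>n. sets (F n))). \<forall>n. A \<inter> {x. \<tau> x \<le> enat n} \<in> sets (F n)}"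
proof -
  have "(\<forall>t. Q t) \<longleftrightarrow> (\<forall>n. Q (enat n)) \<and> Q \<infinity>" for Q
    by (metis enat.exhaust)
  moreover have "{\<omega>\<in>A. \<tau> \<omega> \<le> t} = A \<inter> {x. \<tau> x \<le> t}" for A t
    by blast
  ultimately show ?thesis
    unfolding filtration.sets_pre_sigma[OF filtration_extend[OF F] \<tau>] by auto
qed

lemma is_test_stopped_test:
  assumes F: "filtration (space M) F" and sub: "\<And>n. sets (F n) \<subseteq> sets M"
    and \<phi>s: "sequential_test M F \<phi>s" and \<tau>: "stopping_time (extend_filtration (space M) F) \<tau>"
  shows "is_test M (stopped_test \<phi>s \<tau>)"
  unfolding is_test_def
proof (intro conjI ballI)
  have [measurable]: "\<phi>s n \<in> borel_measurable M" for n
    using \<phi>s by (auto simp: sequential_test_def is_test_def)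
  have "space (extend_filtration (space M) F t) = space M" for t
    using filtration.space_F[OF filtration_extend[OF F]] .
  moreover have "sets (extend_filtration (space M) F t) \<subseteq> sets M" for t
  proof (cases t)
    case (enat n)
    with sub show ?thesis by simp
  next
    case infinity
    have "(\<Union>n. sets (F n)) \<subseteq> Pow (space M)"
      using sub sets.space_closed[of M] by blast
    then show ?thesis
      using infinity sub by (simp add: sets_measure_of sets.sigma_sets_subset UN_least)
  qed
  ultimately have "\<tau> \<in> M \<rightarrow>\<^sub>M borel"
    by (intro measurable_stopping_time[OF \<tau>])
  then have [measurable]: "\<tau> \<in> M \<rightarrow>\<^sub>M count_space UNIV"
    by (subst measurable_count_space_eq2_countable) (auto intro: measurable_sets)
  show "stopped_test \<phi>s \<tau> \<in> borel_measurable M"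
    unfolding stopped_test_def by measurable
next
  fix x assume x: "x \<in> space M"
  have b: "0 \<le> \<phi>s n x" "\<phi>s n x \<le> 1" for n
    using \<phi>s x by (auto simp: sequential_test_def is_test_def)
  have "0 \<le> limsup (\<lambda>n. ereal (\<phi>s n x))"
    by (intro le_Limsup) (auto simp: b)
  moreover have "limsup (\<lambda>n. ereal (\<phi>s n x)) \<le> 1"
    by (intro Limsup_bounded) (auto simp: b)
  ultimately show "stopped_test \<phi>s \<tau> x \<in> {0..1}"
    using b by (cases "limsup (\<lambda>n. ereal (\<phi>s n x))") (auto simp: stopped_test_def split: enat.split)
qed

lemma induced_sequential_test_exists:
  assumes "prob_space P" and F: "filtration (space P) F" and sub: "\<And>n. sets (F n) \<subseteq> sets P"
    and \<phi>: "is_test P \<phi>"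
  shows "\<exists>\<phi>s. induced_sequential_test P F \<phi> \<phi>s"
proof -
  interpret prob_space P by fact
  have sa: "subalgebra P (F n)" for n
    using sub filtration.space_F[OF F] by (auto simp: subalgebra_def)
  have [measurable]: "\<phi> \<in> borel_measurable P" and b: "\<And>x. x \<in> space P \<Longrightarrow> \<phi> x \<in> {0..1}"
    using \<phi> by (auto simp: is_test_def)
  have int: "integrable P \<phi>"
    using b by (intro integrable_const_bound[of _ 1]) auto
  define \<phi>s where "\<phi>s n x = max 0 (min 1 (real_cond_exp P (F n) \<phi> x))" for n x
  have m: "\<phi>s n \<in> borel_measurable (F n)" for n
    unfolding \<phi>s_def by measurable
  have "AE x in P. \<phi>s n x = real_cond_exp P (F n) \<phi> x" for n
  proof -
    interpret finite_measure_subalgebra P "F n"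
      by unfold_locales (rule sa)
    have "AE x in P. real_cond_exp P (F n) \<phi> x \<ge> 0"
      using b by (intro real_cond_exp_ge_c[OF int]) auto
    moreover have "AE x in P. real_cond_exp P (F n) \<phi> x \<le> 1"
      using b by (intro real_cond_exp_le_c[OF int]) auto
    ultimately show ?thesis
      by eventually_elim (simp add: \<phi>s_def)
  qed
  moreover have "sequential_test P F \<phi>s"
    using m measurable_from_subalg[OF sa m]
    by (auto simp: sequential_test_def is_test_def) (auto simp: \<phi>s_def)
  ultimately show ?thesis
    by (auto simp: induced_sequential_test_def)
qed

end

theory Submission
  imports Defs
begin

text \<open>
  All three claims follow from one identity: almost surely, \<open>stopped_test \<phi>s \<tau>\<close> at \<open>x\<close> is the
  conditional expectation of \<open>\<phi>\<close> given \<open>G (\<tau> x)\<close>, where \<open>G\<close> is the filtration extended to time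
  \<open>\<infinity>\<close> (\<open>stopped_test_eq_cond_exp\<close>). On finite times this is the definition of the induced
  sequential test. At time \<open>\<infinity>\<close> it says that the limit superior of the closed martingale
  \<open>E[\<phi> | F n]\<close> is \<open>E[\<phi> | F_lim]\<close>, which is Levy's upward theorem (\<open>levy_upward\<close>).

  Given the identity, splitting the space into the countably many events \<open>\<tau> = t\<close>, each in \<open>G t\<close>,
  shows that the stopped test has the same expectation as \<open>\<phi>\<close> (\<open>integral_stopped_cond_exp\<close>), so
  that validity of one is validity of the other. If \<open>\<phi>\<close> is measurable with respect to the
  \<open>\<sigma>\<close>-algebra of \<open>\<tau>\<close>, then on the event \<open>\<tau> = t\<close> it is \<open>G t\<close>-measurable and hence equal to its
  conditional expectation there (\<open>cond_exp_at_stopping_time_eq\<close>).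

  Levy's theorem is proved for integrable \<open>f\<close> without upcrossings. Let \<open>X n\<close> be \<open>E[f | F n]\<close> and
  suppose that \<open>X n > b\<close> infinitely often on some \<open>B\<close> in \<open>F_lim\<close>. Approximate \<open>B\<close> by some
  \<open>A\<close> in \<open>F m\<close>, and keep of \<open>A\<close> only the points at which \<open>X\<close> exceeds \<open>b\<close> at some time from \<open>m\<close> on.
  This keeps all of \<open>A \<inter> B\<close>, so the remaining set is still close to \<open>B\<close>; and decomposing it by the
  first such time, the integral of \<open>f - b\<close> over it is nonnegative. Hence \<open>f - b\<close> has nonnegative
  integral over \<open>B\<close> as well. Taking for \<open>B\<close> the event that moreover \<open>E[f | F_lim] < b\<close>, this
  forces \<open>B\<close> to be null. Ranging over rational \<open>b\<close> bounds the limit superior of \<open>X\<close> by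
  \<open>E[f | F_lim]\<close>, and \<open>-f\<close> in place of \<open>f\<close> gives the lower bound.
\<close>

section \<open>The limit of a filtration\<close>

locale finite_measure_filtration = finite_measure M + filtration "space M" F
  for M :: "'a measure" and F :: "nat \<Rightarrow> 'a measure" +
  assumes sets_F_subset: "sets (F n) \<subseteq> sets M"
begin

definition F_lim :: "'a measure" where
  "F_lim = sigma (space M) (\<Union>n. sets (F n))"

lemma subset_Pow: "(\<Union>n. sets (F n)) \<subseteq> Pow (space M)"
  using sets_F_subset sets.space_closed[of M] by blast

lemma space_F_lim: "space F_lim = space M"
  using subset_Pow by (simp add: F_lim_def space_measure_of)

lemma sets_F_lim: "sets F_lim = sigma_sets (space M) (\<Union>n. sets (F n))"
  using subset_Pow by (simp add: F_lim_def sets_measure_of)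

lemma subalgebra_F: "subalgebra M (F n)"
  using sets_F_subset by (auto simp: subalgebra_def space_F)

lemma subalgebra_F_lim: "subalgebra M F_lim"
  using sets_F_subset by (auto simp: subalgebra_def space_F_lim sets_F_lim sets.sigma_sets_subset UN_least)

lemma sets_F_subset_F_lim: "sets (F n) \<subseteq> sets F_lim"
  by (auto simp: sets_F_lim)

sublocale F: finite_measure_subalgebra M "F n" for n
  by unfold_locales (rule subalgebra_F)

sublocale F_lim: finite_measure_subalgebra M F_lim
  by unfold_locales (rule subalgebra_F_lim)

text \<open>
  The sets that can be approximated by members of the filtration form a \<open>\<sigma>\<close>-algebra: a countable
  union is first cut down to finitely many sets, and finitely many approximants lie in a common
  \<open>F m\<close>. Allowing any finite \<open>N\<close> makes it possible to weight the error by a density.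
\<close>

lemma F_lim_approx:
  assumes "finite_measure N" "space N = space M" "sets N = sets M"
    and "B \<in> sets F_lim" "e > 0"
  shows "\<exists>m. \<exists>A\<in>sets (F m). measure N (sym_diff A B) < e"
proof -
  interpret N: finite_measure N by fact
  have F_N: "A \<in> sets N" if "A \<in> sets (F m)" for A m
    using that sets_F_subset assms(3) by auto
  define approx where "approx B \<longleftrightarrow> B \<in> sets N \<and>
    (\<forall>e>0. \<exists>m. \<exists>A\<in>sets (F m). measure N (sym_diff A B) < e)" for B
  have Un: "approx (B \<union> C)" if B: "approx B" and C: "approx C" for B C
    unfolding approx_def
  proof (intro conjI allI impI)
    show "B \<union> C \<in> sets N" using B C by (auto simp: approx_def)
    fix e :: real assume "e > 0"
    then obtain m k A D where A: "A \<in> sets (F m)" "measure N (sym_diff A B) < e / 2"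
      and D: "D \<in> sets (F k)" "measure N (sym_diff D C) < e / 2"
      using B C unfolding approx_def by (meson half_gt_zero)
    have [measurable]: "A \<in> sets N" "B \<in> sets N" "C \<in> sets N" "D \<in> sets N"
      using A D B C F_N by (auto simp: approx_def)
    have "measure N (sym_diff (A \<union> D) (B \<union> C)) \<le> measure N (sym_diff A B \<union> sym_diff D C)"
      by (intro N.finite_measure_mono) auto
    also have "\<dots> \<le> measure N (sym_diff A B) + measure N (sym_diff D C)"
      by (intro measure_Un_le) auto
    also have "\<dots> < e" using A D by simp
    finally have "measure N (sym_diff (A \<union> D) (B \<union> C)) < e" .
    moreover have "A \<union> D \<in> sets (F (max m k))"
      using A D sets_F_mono[of m "max m k"] sets_F_mono[of k "max m k"] by auto
    ultimately show "\<exists>m. \<exists>A\<in>sets (F m). measure N (sym_diff A (B \<union> C)) < e" by blast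
  qed
  have "approx B"
    using \<open>B \<in> sets F_lim\<close> unfolding sets_F_lim
  proof (induction rule: sigma_sets.induct)
    case (Basic A)
    then obtain m where "A \<in> sets (F m)" by auto
    moreover have "measure N (sym_diff A A) = 0" by simp
    ultimately show ?case using F_N unfolding approx_def by metis
  next
    case Empty
    have "measure N (sym_diff {} {}) = 0" by simp
    then show ?case unfolding approx_def by (metis sets.empty_sets)
  next
    case (Compl A)
    then have A: "A \<in> sets N" by (simp add: approx_def)
    show ?case
      unfolding approx_def
    proof (intro conjI allI impI)
      show "space M - A \<in> sets N" using A assms(2) by (metis sets.compl_sets)
      fix e :: real assume "e > 0"
      then obtain m D where D: "D \<in> sets (F m)" "measure N (sym_diff D A) < e"
        using Compl by (auto simp: approx_def)
      have "sym_diff (space M - D) (space M - A) = sym_diff D A"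
        using sets.sets_into_space[OF A] sets.sets_into_space[OF D(1)] assms(2) by (auto simp: space_F)
      moreover have "space M - D \<in> sets (F m)" using D by (metis sets.compl_sets space_F)
      ultimately show "\<exists>m. \<exists>D\<in>sets (F m). measure N (sym_diff D (space M - A)) < e"
        using D by metis
    qed
  next
    case (Union B)
    define C where "C k = (\<Union>i\<le>k. B i)" for k :: nat
    have C: "approx (C k)" for k
    proof (induction k)
      case 0
      show ?case using Union by (simp add: C_def)
    next
      case (Suc k)
      have "C (Suc k) = C k \<union> B (Suc k)" by (auto simp: C_def atMost_Suc)
      then show ?case using Un[OF Suc Union.IH] by simp
    qed
    have UC: "(\<Union>i. B i) = (\<Union>k. C k)" by (auto simp: C_def)
    have [measurable]: "C k \<in> sets N" for k using C by (simp add: approx_def)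
    have UCm[measurable]: "(\<Union>k. C k) \<in> sets N" by auto
    have inc: "incseq C" unfolding incseq_def C_def by (auto intro: order_trans)
    have lim: "(\<lambda>k. measure N (C k)) \<longlonglongrightarrow> measure N (\<Union>k. C k)"
      by (intro N.finite_Lim_measure_incseq inc) auto
    show ?case
      unfolding approx_def UC
    proof (intro conjI allI impI UCm)
      fix e :: real assume "e > 0"
      then have "eventually (\<lambda>k. measure N (C k) > measure N (\<Union>k. C k) - e / 2) sequentially"
        by (intro order_tendstoD[OF lim]) auto
      then obtain k where k: "measure N (C k) > measure N (\<Union>k. C k) - e / 2"
        by (auto simp: eventually_sequentially)
      from C[of k] \<open>e > 0\<close> obtain m A where A: "A \<in> sets (F m)" "measure N (sym_diff A (C k)) < e / 2"
        by (auto simp: approx_def dest!: spec[of _ "e / 2"])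
      have [measurable]: "A \<in> sets N" using A F_N by auto
      have "measure N (sym_diff A (\<Union>k. C k)) \<le> measure N (sym_diff A (C k) \<union> ((\<Union>k. C k) - C k))"
        by (intro N.finite_measure_mono) auto
      also have "\<dots> \<le> measure N (sym_diff A (C k)) + measure N ((\<Union>k. C k) - C k)"
        by (intro measure_Un_le) auto
      also have "measure N ((\<Union>k. C k) - C k) = measure N (\<Union>k. C k) - measure N (C k)"
        by (intro N.finite_measure_Diff) auto
      finally show "\<exists>m. \<exists>A\<in>sets (F m). measure N (sym_diff A (\<Union>k. C k)) < e"
        using A k by (intro exI[of _ m] bexI[of _ A]) auto
    qed
  qed
  then show ?thesis using \<open>e > 0\<close> by (auto simp: approx_def)
qed

lemma set_integrable: "integrable M f \<Longrightarrow> A \<in> sets M \<Longrightarrow> set_integrable M A f"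
  for f :: "'a \<Rightarrow> real"
  unfolding set_integrable_def by (rule integrable_mult_indicator)

text \<open>
  This is \<open>F_lim_approx\<close> for the finite measure with density \<open>\<bar>h\<bar>\<close>. Choosing this measure replaces
  an appeal to absolute continuity of the integral when \<open>h\<close> is unbounded.
\<close>

lemma F_lim_integral_approx:
  fixes h :: "'a \<Rightarrow> real"
  assumes h: "integrable M h" and B: "B \<in> sets F_lim" and "e > 0"
  obtains m A where "A \<in> sets (F m)" "(\<integral>x\<in>sym_diff A B. \<bar>h x\<bar> \<partial>M) < e"
proof -
  define N where "N = density M (\<lambda>x. ennreal \<bar>h x\<bar>)"
  have [measurable]: "h \<in> borel_measurable M" using h by auto
  have em: "emeasure N D = ennreal (\<integral>x\<in>D. \<bar>h x\<bar> \<partial>M)" if D: "D \<in> sets M" for D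
  proof -
    have "emeasure N D = (\<integral>\<^sup>+x. ennreal \<bar>h x\<bar> * indicator D x \<partial>M)"
      using D by (simp add: N_def emeasure_density)
    also have "\<dots> = (\<integral>\<^sup>+x. ennreal (indicator D x *\<^sub>R \<bar>h x\<bar>) \<partial>M)"
      by (intro nn_integral_cong) (auto split: split_indicator)
    also have "\<dots> = ennreal (\<integral>x\<in>D. \<bar>h x\<bar> \<partial>M)"
      unfolding set_lebesgue_integral_def
      using set_integrable[OF integrable_abs[OF h] D]
      by (intro nn_integral_eq_integral) (auto simp: set_integrable_def)
    finally show ?thesis .
  qed
  have "finite_measure N"
    by (intro finite_measureI) (simp add: em N_def[THEN arg_cong, of space])
  then obtain m A where A: "A \<in> sets (F m)" "measure N (sym_diff A B) < e"
    using F_lim_approx[of N B e] B \<open>e > 0\<close> by (auto simp: N_def)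
  have "A \<in> sets M" "B \<in> sets M"
    using A B subalgebra_F_lim sets_F_subset by (auto simp: subalgebra_def)
  then have "sym_diff A B \<in> sets M" by auto
  moreover have "0 \<le> (\<integral>x\<in>sym_diff A B. \<bar>h x\<bar> \<partial>M)"
    by (auto simp: set_lebesgue_integral_def)
  ultimately have "measure N (sym_diff A B) = (\<integral>x\<in>sym_diff A B. \<bar>h x\<bar> \<partial>M)"
    using em by (simp add: measure_def)
  then show ?thesis using that A by simp
qed

lemma set_integral_diff_le:
  fixes h :: "'a \<Rightarrow> real"
  assumes h: "integrable M h" and [measurable]: "C \<in> sets M" "B \<in> sets M" "D \<in> sets M"
    and "sym_diff C B \<subseteq> D"
  shows "(\<integral>x\<in>C. h x \<partial>M) - (\<integral>x\<in>B. h x \<partial>M) \<le> (\<integral>x\<in>D. \<bar>h x\<bar> \<partial>M)"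
proof -
  have "(\<integral>x\<in>C. h x \<partial>M) - (\<integral>x\<in>B. h x \<partial>M) = (\<integral>x. indicator C x *\<^sub>R h x - indicator B x *\<^sub>R h x \<partial>M)"
    unfolding set_lebesgue_integral_def
    by (rule Bochner_Integration.integral_diff[symmetric]; rule integrable_mult_indicator[OF _ h]; fact)
  also have "\<dots> \<le> (\<integral>x\<in>D. \<bar>h x\<bar> \<partial>M)"
    unfolding set_lebesgue_integral_def
  proof (intro integral_mono)
    fix x show "indicator C x *\<^sub>R h x - indicator B x *\<^sub>R h x \<le> indicator D x *\<^sub>R \<bar>h x\<bar>"
      using \<open>sym_diff C B \<subseteq> D\<close> by (auto split: split_indicator)
  qed (intro integrable_mult_indicator Bochner_Integration.integrable_diff integrable_abs h; fact)+
  finally show ?thesis .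
qed

section \<open>Levy's upward theorem\<close>

lemma set_integral_exceed_nonneg:
  assumes f: "integrable M f" and A: "A \<in> sets (F n)"
    and gt: "\<And>x. x \<in> A \<Longrightarrow> real_cond_exp M (F n) f x > b"
  shows "0 \<le> (\<integral>x\<in>A. f x - b \<partial>M)"
proof -
  have [measurable]: "A \<in> sets M" using A sets_F_subset by auto
  have c: "set_integrable M A (\<lambda>_. b)" by (intro set_integrable) auto
  have "(\<integral>x\<in>A. f x - b \<partial>M) = (\<integral>x\<in>A. f x \<partial>M) - (\<integral>x\<in>A. b \<partial>M)"
    using f by (intro set_integral_diff c set_integrable) auto
  also have "\<dots> = (\<integral>x\<in>A. real_cond_exp M (F n) f x \<partial>M) - (\<integral>x\<in>A. b \<partial>M)"
    using F.real_cond_exp_intA[OF f A] by simp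
  also have "\<dots> \<ge> 0"
    using set_integral_mono[OF c set_integrable[OF F.real_cond_exp_int(1)[OF f, of n] \<open>A \<in> sets M\<close>]] gt
    by (simp add: less_imp_le)
  finally show ?thesis .
qed

text \<open>
  This is Doob's maximal inequality, localised to \<open>A\<close>. The event splits according to the first
  \<open>n \<ge> m\<close> at which the martingale exceeds \<open>b\<close>; the piece belonging to \<open>n\<close> lies in \<open>F n\<close>, so
  \<open>set_integral_exceed_nonneg\<close> applies to it.
\<close>

lemma set_integral_hitting_nonneg:
  assumes f: "integrable M f" and A: "A \<in> sets (F m)"
  shows "0 \<le> (\<integral>x\<in>{x\<in>A. \<exists>n\<ge>m. real_cond_exp M (F n) f x > b}. f x - b \<partial>M)"
proof -
  let ?X = "\<lambda>n. real_cond_exp M (F n) f"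
  define C where "C k = {x\<in>A. \<exists>n\<in>{m..<m + k}. ?X n x > b}" for k
  have int: "integrable M (\<lambda>x. f x - b)" using f by auto
  have meas: "{x\<in>A. ?X n x > b} \<in> sets (F k)" if "m \<le> n" "n \<le> k" for n k
  proof -
    have "A \<in> sets (F n)" using A sets_F_mono[OF \<open>m \<le> n\<close>] by auto
    moreover have "{x\<in>space (F n). ?X n x > b} \<in> sets (F n)" by measurable
    moreover have "{x\<in>A. ?X n x > b} = A \<inter> {x\<in>space (F n). ?X n x > b}"
      using sets.sets_into_space[OF A] by (auto simp: space_F)
    ultimately have "{x\<in>A. ?X n x > b} \<in> sets (F n)" by (simp only: sets.Int)
    then show ?thesis using sets_F_mono[OF \<open>n \<le> k\<close>] by auto
  qed
  have C: "C k \<in> sets (F (m + k))" for k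
  proof -
    have "C k = (\<Union>n\<in>{m..<m + k}. {x\<in>A. ?X n x > b})" by (auto simp: C_def)
    also have "\<dots> \<in> sets (F (m + k))" by (intro sets.finite_UN meas) auto
    finally show ?thesis .
  qed
  then have CM: "C k \<in> sets M" for k using sets_F_subset by blast
  have nonneg: "0 \<le> (\<integral>x\<in>C k. f x - b \<partial>M)" for k
  proof (induction k)
    case 0
    show ?case by (simp add: C_def set_lebesgue_integral_def)
  next
    case (Suc k)
    \<comment> \<open>the points at which \<open>b\<close> is exceeded for the first time at \<open>m + k\<close>\<close>
    let ?D = "{x\<in>A. ?X (m + k) x > b} - C k"
    have D: "?D \<in> sets (F (m + k))" using meas C by auto
    then have DM: "?D \<in> sets M" using sets_F_subset by blast
    have "C (Suc k) = C k \<union> ?D" by (auto simp: C_def less_Suc_eq)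
    moreover have "(\<integral>x\<in>C k \<union> ?D. f x - b \<partial>M) = (\<integral>x\<in>C k. f x - b \<partial>M) + (\<integral>x\<in>?D. f x - b \<partial>M)"
      by (rule set_integral_Un[OF _ set_integrable[OF int CM] set_integrable[OF int DM]]) blast
    moreover have "0 \<le> (\<integral>x\<in>?D. f x - b \<partial>M)"
      by (rule set_integral_exceed_nonneg[OF f D]) auto
    ultimately show ?case using Suc by simp
  qed
  have lim: "(\<lambda>k. \<integral>x\<in>C k. f x - b \<partial>M) \<longlonglongrightarrow> (\<integral>x\<in>(\<Union>k. C k). f x - b \<partial>M)"
    using CM by (intro set_integral_cont_up set_integrable[OF int])
       (fastforce simp: incseq_def C_def)+
  have UN: "(\<Union>k. C k) = {x\<in>A. \<exists>n\<ge>m. ?X n x > b}"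
  proof -
    have "x \<in> C (Suc (n - m))" if "x \<in> A" "n \<ge> m" "?X n x > b" for x n
      using that by (auto simp: C_def intro!: bexI[of _ n])
    then have "{x\<in>A. \<exists>n\<ge>m. ?X n x > b} \<subseteq> (\<Union>k. C k)" by blast
    moreover have "(\<Union>k. C k) \<subseteq> {x\<in>A. \<exists>n\<ge>m. ?X n x > b}" by (auto simp: C_def)
    ultimately show ?thesis by blast
  qed
  show ?thesis
    using LIMSEQ_le_const[OF lim, of 0] nonneg unfolding UN by simp
qed

text \<open>
  The maximal inequality holds only for \<open>A\<close> in some \<open>F m\<close>, and this lemma carries it over to \<open>F_lim\<close>.
  Exceeding \<open>b\<close> infinitely often, rather than once, is what allows this: the approximant of \<open>B\<close>
  may lie in \<open>F m\<close> with \<open>m\<close> large, and \<open>b\<close> must still be exceeded from time \<open>m\<close> on.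
\<close>

lemma set_integral_infinitely_often_nonneg:
  assumes f: "integrable M f" and B: "B \<in> sets F_lim"
    and io: "\<And>x. x \<in> B \<Longrightarrow> \<exists>\<^sub>\<infinity>n. real_cond_exp M (F n) f x > b"
  shows "0 \<le> (\<integral>x\<in>B. f x - b \<partial>M)"
proof (rule field_le_epsilon)
  fix e :: real assume "e > 0"
  have int: "integrable M (\<lambda>x. f x - b)" using f by auto
  obtain m A where A: "A \<in> sets (F m)" and e: "(\<integral>x\<in>sym_diff A B. \<bar>f x - b\<bar> \<partial>M) < e"
    using F_lim_integral_approx[OF int B \<open>e > 0\<close>] by blast
  let ?C = "{x\<in>A. \<exists>n\<ge>m. real_cond_exp M (F n) f x > b}"
  have [measurable]: "A \<in> sets M" "B \<in> sets M"
    using A B sets_F_subset subalgebra_F_lim by (auto simp: subalgebra_def)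
  have [measurable]: "real_cond_exp M (F n) f \<in> borel_measurable M" for n
    by (rule borel_measurable_cond_exp2)
  have "?C = A \<inter> {x\<in>space M. \<exists>n\<ge>m. real_cond_exp M (F n) f x > b}"
    using sets.sets_into_space[OF \<open>A \<in> sets M\<close>] by auto
  also have "\<dots> \<in> sets M" by measurable
  finally have C: "?C \<in> sets M" .
  \<comment> \<open>passing from \<open>A\<close> to \<open>?C\<close> loses no point of \<open>B\<close>\<close>
  have "sym_diff ?C B \<subseteq> sym_diff A B"
    using io by (auto simp: INFM_nat_le)
  then have "(\<integral>x\<in>?C. f x - b \<partial>M) - (\<integral>x\<in>B. f x - b \<partial>M) \<le> (\<integral>x\<in>sym_diff A B. \<bar>f x - b\<bar> \<partial>M)"
    using C by (intro set_integral_diff_le[OF int]) auto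
  with e set_integral_hitting_nonneg[OF f A, of b] show "0 \<le> (\<integral>x\<in>B. f x - b \<partial>M) + e"
    by linarith
qed

text \<open>
  On the exceptional event \<open>B\<close> the integral of \<open>f - b\<close> is nonnegative by the previous lemma, but it
  equals that of \<open>E[f | F_lim] - b\<close>, a function that is negative at every point of \<open>B\<close>.
\<close>

lemma AE_eventually_le:
  assumes f: "integrable M f"
  shows "AE x in M. real_cond_exp M F_lim f x < b \<longrightarrow>
    (\<forall>\<^sub>F n in sequentially. real_cond_exp M (F n) f x \<le> b)"
proof -
  let ?X = "\<lambda>n. real_cond_exp M (F n) f" and ?g = "real_cond_exp M F_lim f"
  define B where "B = {x\<in>space M. ?g x < b \<and> (\<exists>\<^sub>\<infinity>n. ?X n x > b)}"
  have [measurable]: "?X n \<in> borel_measurable F_lim" for n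
    using borel_measurable_cond_exp[of M "F n" f] sets_F_subset_F_lim
    by (intro measurable_from_subalg[of F_lim "F n"]) (auto simp: subalgebra_def space_F space_F_lim)
  have "B = {x\<in>space F_lim. ?g x < b \<and> (\<forall>k. \<exists>n\<ge>k. ?X n x > b)}"
    by (simp add: B_def space_F_lim INFM_nat_le)
  also have "\<dots> \<in> sets F_lim" by measurable
  finally have B: "B \<in> sets F_lim" .
  then have BM: "B \<in> sets M" using subalgebra_F_lim by (auto simp: subalgebra_def)
  let ?d = "\<lambda>x. indicator B x * (b - ?g x)"
  have g: "integrable M ?g" by (rule F_lim.real_cond_exp_int(1)[OF f])
  have c: "set_integrable M B (\<lambda>_. b)" using BM by (intro set_integrable) auto
  have "0 \<le> (\<integral>x\<in>B. f x - b \<partial>M)"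
    by (rule set_integral_infinitely_often_nonneg[OF f B]) (auto simp: B_def)
  also have "\<dots> = (\<integral>x\<in>B. f x \<partial>M) - (\<integral>x\<in>B. b \<partial>M)"
    using f BM by (intro set_integral_diff c set_integrable) auto
  also have "\<dots> = (\<integral>x\<in>B. ?g x \<partial>M) - (\<integral>x\<in>B. b \<partial>M)"
    using F_lim.real_cond_exp_intA[OF f B] by simp
  also have "\<dots> = - ((\<integral>x\<in>B. b \<partial>M) - (\<integral>x\<in>B. ?g x \<partial>M))" by simp
  also have "(\<integral>x\<in>B. b \<partial>M) - (\<integral>x\<in>B. ?g x \<partial>M) = (\<integral>x\<in>B. b - ?g x \<partial>M)"
    using g BM by (intro set_integral_diff(2)[symmetric] c set_integrable) auto
  finally have le: "(\<integral>x. ?d x \<partial>M) \<le> 0" by (simp add: set_lebesgue_integral_def)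
  have nonneg: "0 \<le> ?d x" for x by (auto simp: B_def split: split_indicator)
  have "integrable M ?d"
    using integrable_mult_indicator[OF BM, of "\<lambda>x. b - ?g x"] g by simp
  moreover have "(\<integral>x. ?d x \<partial>M) = 0"
    using le nonneg by (intro antisym integral_nonneg) auto
  ultimately have "AE x in M. ?d x = 0"
    using nonneg by (subst (asm) integral_nonneg_eq_0_iff_AE) auto
  then show ?thesis
    using AE_space
    by eventually_elim
      (auto simp: B_def indicator_def not_less[symmetric] frequently_cofinite cofinite_eq_sequentially not_frequently split: if_splits)
qed

theorem levy_upward:
  assumes f: "integrable M f"
  shows "AE x in M. (\<lambda>n. real_cond_exp M (F n) f x) \<longlonglongrightarrow> real_cond_exp M F_lim f x"
proof -
  let ?X = "\<lambda>n. real_cond_exp M (F n)" and ?g = "real_cond_exp M F_lim"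
  \<comment> \<open>written as a multiple of \<open>f\<close> so that \<open>real_cond_exp_cmult\<close> applies\<close>
  have f': "integrable M (\<lambda>x. -1 * f x)" using f by simp
  have "AE x in M. \<forall>q::rat. ?g f x < real_of_rat q \<longrightarrow>
      (\<forall>\<^sub>F n in sequentially. ?X n f x \<le> real_of_rat q)"
    unfolding AE_all_countable using AE_eventually_le[OF f] by blast
  moreover have "AE x in M. \<forall>q::rat. ?g (\<lambda>x. -1 * f x) x < real_of_rat q \<longrightarrow>
      (\<forall>\<^sub>F n in sequentially. ?X n (\<lambda>x. -1 * f x) x \<le> real_of_rat q)"
    unfolding AE_all_countable using AE_eventually_le[OF f'] by blast
  moreover have "AE x in M. \<forall>n. ?X n (\<lambda>x. -1 * f x) x = -1 * ?X n f x"
    unfolding AE_all_countable using F.real_cond_exp_cmult[OF f] by blast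
  moreover have "AE x in M. ?g (\<lambda>x. -1 * f x) x = -1 * ?g f x"
    by (rule F_lim.real_cond_exp_cmult[OF f])
  ultimately show ?thesis
  proof eventually_elim
    case (elim x)
    show ?case
    proof (rule order_tendstoI)
      fix a assume "?g f x < a"
      then obtain q where "?g f x < real_of_rat q" "real_of_rat q < a"
        using of_rat_dense by blast
      then show "\<forall>\<^sub>F n in sequentially. ?X n f x < a"
        using elim(1) by (auto elim!: eventually_mono allE[of _ q])
    next
      fix a assume "a < ?g f x"
      then have "- ?g f x < - a" by simp
      then obtain q where "- ?g f x < real_of_rat q" "real_of_rat q < - a"
        using of_rat_dense by blast
      then have "\<forall>\<^sub>F n in sequentially. ?X n (\<lambda>x. -1 * f x) x \<le> real_of_rat q"
        using elim(2,4) by auto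
      then show "\<forall>\<^sub>F n in sequentially. a < ?X n f x"
        using \<open>real_of_rat q < - a\<close> elim(3) by (auto elim!: eventually_mono)
    qed
  qed
qed

end

section \<open>Conditional expectations at a random time\<close>

text \<open>
  For a countable index type, optional stopping of a closed martingale is a sum over the level sets
  of \<open>\<tau>\<close>. The hypothesis on \<open>h\<close> is an almost sure equation because conditional expectations are
  determined only up to null sets.
\<close>

lemma (in finite_measure) integral_stopped_cond_exp:
  fixes G :: "'b :: countable \<Rightarrow> 'a measure" and \<tau> :: "'a \<Rightarrow> 'b"
  assumes G: "\<And>t. subalgebra M (G t)" and \<tau>: "\<And>t. {x\<in>space M. \<tau> x = t} \<in> sets (G t)"
    and f: "integrable M f" and h: "integrable M h"
    and eq: "AE x in M. h x = real_cond_exp M (G (\<tau> x)) f x"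
  shows "(\<integral>x. h x \<partial>M) = (\<integral>x. f x \<partial>M)"
proof -
  define A where "A i = {x\<in>space M. to_nat (\<tau> x) = i}" for i
  have \<tau>M: "{x\<in>space M. \<tau> x = t} \<in> sets M" for t
    using \<tau> G by (auto simp: subalgebra_def)
  have si: "set_integrable M S k" if "integrable M k" "S \<in> sets M" for S and k :: "'a \<Rightarrow> real"
    using that unfolding set_integrable_def by (intro integrable_mult_indicator)
  have level: "(\<integral>x\<in>{x\<in>space M. \<tau> x = t}. h x - f x \<partial>M) = 0" for t
  proof -
    interpret finite_measure_subalgebra M "G t" by unfold_locales (rule G)
    let ?S = "{x\<in>space M. \<tau> x = t}"
    have [measurable]: "?S \<in> sets M" by (rule \<tau>M)
    have [measurable]: "h \<in> borel_measurable M" using h by auto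
    have "(\<integral>x\<in>?S. h x - f x \<partial>M) = (\<integral>x\<in>?S. h x \<partial>M) - (\<integral>x\<in>?S. f x \<partial>M)"
      by (intro set_integral_diff si f h \<tau>M)
    also have "(\<integral>x\<in>?S. h x \<partial>M) = (\<integral>x\<in>?S. real_cond_exp M (G t) f x \<partial>M)"
      using eq by (intro set_lebesgue_integral_cong_AE) auto
    also have "\<dots> = (\<integral>x\<in>?S. f x \<partial>M)" by (rule real_cond_exp_intA[OF f \<tau>, symmetric])
    finally show ?thesis by simp
  qed
  have A_cases: "A i = {} \<or> (\<exists>t. A i = {x\<in>space M. \<tau> x = t})" for i
    by (auto simp: A_def)
  have A: "A i \<in> sets M" for i
    using A_cases[of i] \<tau>M by (metis sets.empty_sets)
  have UN: "(\<Union>i. A i) = space M" by (auto simp: A_def)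
  have int: "integrable M (\<lambda>x. h x - f x)" using h f by auto
  have "(\<integral>x. h x - f x \<partial>M) = (\<integral>x\<in>(\<Union>i. A i). h x - f x \<partial>M)"
    unfolding UN by (simp add: set_integral_space[OF int])
  also have "\<dots> = (\<Sum>i. \<integral>x\<in>A i. h x - f x \<partial>M)"
    using si[OF int sets.top] by (intro lebesgue_integral_countable_add A) (simp_all only: UN, auto simp: A_def)
  also have "(\<lambda>i. \<integral>x\<in>A i. h x - f x \<partial>M) = (\<lambda>_. 0)"
  proof
    fix i show "(\<integral>x\<in>A i. h x - f x \<partial>M) = 0"
      using A_cases[of i]
    proof
      assume "A i = {}"
      then show ?thesis by (simp add: set_lebesgue_integral_def)
    qed (metis level)
  qed
  finally have "(\<integral>x. h x - f x \<partial>M) = 0" by simp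
  then show ?thesis using h f by simp
qed

text \<open>
  On the event \<open>\<tau> = t\<close>, the function \<open>f\<close> agrees with \<open>f\<close> times the indicator of that event. This
  product is \<open>G t\<close>-measurable, and the indicator can be taken out of the conditional expectation.
\<close>

lemma (in finite_measure) cond_exp_at_stopping_time_eq:
  fixes G :: "'b :: {countable, linorder_topology, second_countable_topology} \<Rightarrow> 'a measure"
  assumes filt: "filtration (space M) G" and G: "\<And>t. sets (G t) \<subseteq> sets M"
    and \<tau>: "stopping_time G \<tau>" and f: "integrable M f"
    and meas: "f \<in> borel_measurable (filtration.pre_sigma (space M) G \<tau>)"
  shows "AE x in M. real_cond_exp M (G (\<tau> x)) f x = f x"
proof -
  interpret filtration "space M" G by fact
  have "AE x in M. \<tau> x = t \<longrightarrow> real_cond_exp M (G t) f x = f x" for t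
  proof -
    interpret finite_measure_subalgebra M "G t"
      using G by unfold_locales (auto simp: subalgebra_def space_F)
    let ?I = "indicator {x. \<tau> x = t} :: 'a \<Rightarrow> real"
    have [measurable]: "Measurable.pred (G t) (\<lambda>x. \<tau> x = t)"
      by (rule stopping_time_eq_const[OF \<tau>])
    have I: "?I \<in> borel_measurable (G t)" by measurable
    have [measurable]: "f \<in> borel_measurable M" using f by auto
    have IM[measurable]: "?I \<in> borel_measurable M"
      by (rule measurable_from_subalg[OF subalg I])
    have int: "integrable M (\<lambda>x. ?I x * f x)"
      using f by (rule Bochner_Integration.integrable_bound) (auto split: split_indicator)
    have "(\<lambda>x. ?I x * f x) \<in> borel_measurable (G t)"
    proof (rule measurableI)
      fix S :: "real set" assume S: "S \<in> sets borel"
      have "f -` S \<inter> space M \<in> sets (pre_sigma \<tau>)"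
        using measurable_sets[OF meas S] by (simp add: space_pre_sigma)
      then have "{x\<in>f -` S \<inter> space M. \<tau> x \<le> t} \<in> sets (G t)"
        by (rule sets_pre_sigmaD[OF \<tau>])
      moreover have eq: "{x\<in>space (G t). \<tau> x = t} \<in> sets (G t)" by measurable
      ultimately have "{x\<in>f -` S \<inter> space M. \<tau> x \<le> t} \<inter> {x\<in>space (G t). \<tau> x = t} \<in> sets (G t)"
        by (rule sets.Int)
      moreover have "(if 0 \<in> S then space (G t) - {x\<in>space (G t). \<tau> x = t} else {}) \<in> sets (G t)"
        using eq by auto
      ultimately have "({x\<in>f -` S \<inter> space M. \<tau> x \<le> t} \<inter> {x\<in>space (G t). \<tau> x = t}) \<union>
        (if 0 \<in> S then space (G t) - {x\<in>space (G t). \<tau> x = t} else {}) \<in> sets (G t)"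
        by (rule sets.Un)
      also have "({x\<in>f -` S \<inter> space M. \<tau> x \<le> t} \<inter> {x\<in>space (G t). \<tau> x = t}) \<union>
        (if 0 \<in> S then space (G t) - {x\<in>space (G t). \<tau> x = t} else {}) =
        (\<lambda>x. ?I x * f x) -` S \<inter> space (G t)"
        by (auto simp: space_F split: split_indicator_asm)
      finally show "(\<lambda>x. ?I x * f x) -` S \<inter> space (G t) \<in> sets (G t)" .
    qed simp
    then have "AE x in M. real_cond_exp M (G t) (\<lambda>x. ?I x * f x) x = ?I x * f x"
      by (intro real_cond_exp_F_meas int)
    moreover have "AE x in M. real_cond_exp M (G t) (\<lambda>x. ?I x * f x) x = ?I x * real_cond_exp M (G t) f x"
      by (intro real_cond_exp_mult I int) auto
    ultimately show ?thesis
      by eventually_elim auto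
  qed
  then have "AE x in M. \<forall>t. \<tau> x = t \<longrightarrow> real_cond_exp M (G t) f x = f x"
    by (intro AE_all_countable[THEN iffD2] allI)
  then show ?thesis by eventually_elim auto
qed

section \<open>Stopping the induced sequential test\<close>

lemma stopped_test_eq_cond_exp:
  assumes "prob_space P" and filt: "filtration (space P) F" and sub: "\<And>n. sets (F n) \<subseteq> sets P"
    and \<phi>: "is_test P \<phi>" and \<phi>s: "induced_sequential_test P F \<phi> \<phi>s"
  shows "AE x in P. stopped_test \<phi>s \<tau> x =
    real_cond_exp P (extend_filtration (space P) F (\<tau> x)) \<phi> x"
proof -
  interpret prob_space P by fact
  interpret filtration "space P" F by fact
  interpret finite_measure_filtration P F
    by unfold_locales (rule sub)
  have int: "integrable P \<phi>"
    using \<phi> by (intro integrable_const_bound[of _ 1]) (auto simp: is_test_def)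
  have "AE x in P. \<forall>n. \<phi>s n x = real_cond_exp P (F n) \<phi> x"
    using \<phi>s by (simp add: AE_all_countable induced_sequential_test_def)
  with levy_upward[OF int] show ?thesis
  proof eventually_elim
    case (elim x)
    then have "(\<lambda>n. ereal (\<phi>s n x)) \<longlonglongrightarrow> ereal (real_cond_exp P F_lim \<phi> x)"
      by simp
    then have "limsup (\<lambda>n. ereal (\<phi>s n x)) = ereal (real_cond_exp P F_lim \<phi> x)"
      by (intro lim_imp_Limsup) auto
    then show ?case
      using elim by (cases "\<tau> x") (auto simp: stopped_test_def F_lim_def)
  qed
qed

theorem theorem1:
  fixes P :: "'a measure" and F :: "nat \<Rightarrow> 'a measure" and \<alpha> :: real
    and \<phi> :: "'a \<Rightarrow> real" and \<phi>s :: "nat \<Rightarrow> 'a \<Rightarrow> real"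
  assumes "prob_space P"
    and "filtration (space P) F"
    and "\<And>n. sets (F n) \<subseteq> sets P"
    and "sets (F 0) = {{}, space P}"
    and "\<alpha> > 0"
    and "is_test P \<phi>"
    and "induced_sequential_test P F \<phi> \<phi>s"
  shows
    "(valid \<alpha> {P} \<phi> \<longrightarrow> anytime_valid \<alpha> {P} (space P) F \<phi>s) \<and>
     (\<not> valid \<alpha> {P} \<phi> \<longrightarrow>
       (\<forall>\<tau>. stopping_time (extend_filtration (space P) F) \<tau> \<longrightarrow>
         \<not> valid \<alpha> {P} (stopped_test \<phi>s \<tau>))) \<and>
     (\<forall>\<tau>. stopping_time (extend_filtration (space P) F) \<tau> \<and>
         \<phi> \<in> borel_measurable (filtration.pre_sigma (space P) (extend_filtration (space P) F) \<tau>) \<longrightarrow>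
       (AE x in P. stopped_test \<phi>s \<tau> x = \<phi> x))"
proof -
  interpret prob_space P by fact
  let ?G = "extend_filtration (space P) F"
  interpret G: filtration "space P" ?G
    by (rule filtration_extend) fact
  interpret F: filtration "space P" F by fact
  interpret finite_measure_filtration P F
    by unfold_locales fact
  have sub: "subalgebra P (?G t)" for t
    using subalgebra_F subalgebra_F_lim by (cases t) (simp_all add: F_lim_def)
  have test_int: "integrable P \<psi>" if "is_test P \<psi>" for \<psi>
    using that by (intro integrable_const_bound[of _ 1]) (auto simp: is_test_def)
  have AE_eq: "AE x in P. stopped_test \<phi>s \<tau> x = real_cond_exp P (?G (\<tau> x)) \<phi> x" for \<tau>
    by (rule stopped_test_eq_cond_exp) fact+
  have integral_eq: "(\<integral>x. stopped_test \<phi>s \<tau> x \<partial>P) = (\<integral>x. \<phi> x \<partial>P)"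
    if \<tau>: "stopping_time ?G \<tau>" for \<tau>
  proof (rule integral_stopped_cond_exp[OF sub _ _ _ AE_eq])
    show "{x\<in>space P. \<tau> x = t} \<in> sets (?G t)" for t
      using G.stopping_time_eq_const[OF \<tau>] by (simp add: pred_def G.space_F)
    show "integrable P \<phi>" by (rule test_int) fact
    have "sequential_test P F \<phi>s" using assms(7) by (simp add: induced_sequential_test_def)
    then show "integrable P (stopped_test \<phi>s \<tau>)"
      by (intro test_int is_test_stopped_test[OF assms(2,3) _ \<tau>])
  qed
  have "AE x in P. stopped_test \<phi>s \<tau> x = \<phi> x"
    if \<tau>: "stopping_time ?G \<tau>" and meas: "\<phi> \<in> borel_measurable (G.pre_sigma \<tau>)" for \<tau>
  proof -
    have "AE x in P. real_cond_exp P (?G (\<tau> x)) \<phi> x = \<phi> x"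
      using sub by (intro cond_exp_at_stopping_time_eq[OF G.filtration_axioms _ \<tau> test_int[OF assms(6)] meas])
        (auto simp: subalgebra_def)
    with AE_eq[of \<tau>] show ?thesis by eventually_elim simp
  qed
  then show ?thesis
    by (auto simp: valid_def anytime_valid_def integral_eq)
qed

end
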